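(* Let $n\ge 2$, let $\theta_1,\dots,\theta_n>0$, and let $H:\mathbb{R}_+^n\to\mathbb{R}_+^n$ be the quadratic operator $H(x)=x'$ with $$x_k'=\frac{\theta_k x_k}{2}\Big(x_k+2\sum_{i\ne k}x_i\Big),\qquad k=1,\dots,n.$$ Then $H$ has no attracting fixed point other than the origin $(0,\dots,0)$.
   Context: $\mathbb{R}_+^n=\{x\in\mathbb{R}^n: x_i\ge 0 \text{ for all } i\}$. A fixed point is attracting if all eigenvalues of the Jacobian matrix of $H$ at it have absolute value less than $1$ ($H$ is a polynomial map, so its Jacobian is defined everywhere). *)

theory Defs
  imports "HOL-Analysis.Analysis"
begin

definition nonneg_orthant :: "(real ^ 'n) set" where
  "nonneg_orthant = {x. \<forall>i. 0 \<le> x $ i}"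

(* The same polynomial formula on all of R^n, so that the Jacobian is also
   available at boundary points of the orthant. *)
definition quad_op :: "real ^ 'n \<Rightarrow> real ^ 'n \<Rightarrow> real ^ 'n" where
  "quad_op \<theta> x = (\<chi> k. \<theta> $ k * x $ k / 2 * (x $ k + 2 * (\<Sum>i\<in>UNIV - {k}. x $ i)))"

(* Eigenvalues of a real matrix are taken over the complex numbers. *)
definition complex_eigenvalue :: "real ^ 'n ^ 'n \<Rightarrow> complex \<Rightarrow> bool" where
  "complex_eigenvalue A \<mu> \<longleftrightarrow>
     (\<exists>v :: complex ^ 'n. v \<noteq> 0 \<and> map_matrix complex_of_real A *v v = \<mu> *s v)"

(* The constant jacobian is meaningful only where F is differentiable;
   see quad_op_differentiable below. *)
definition attracting_fixed_point :: "(real ^ 'n \<Rightarrow> real ^ 'n) \<Rightarrow> real ^ 'n \<Rightarrow> bool" where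
  "attracting_fixed_point F p \<longleftrightarrow>
     F p = p \<and> (\<forall>\<mu>. complex_eigenvalue (jacobian F (at p)) \<mu> \<longrightarrow> cmod \<mu> < 1)"

lemma quad_op_nonneg_orthant:
  assumes "\<And>k. 0 < \<theta> $ k" and "x \<in> nonneg_orthant"
  shows "quad_op \<theta> x \<in> nonneg_orthant"
  using assms unfolding nonneg_orthant_def quad_op_def
  by (auto intro!: mult_nonneg_nonneg add_nonneg_nonneg sum_nonneg simp: less_imp_le)

lemma quad_op_differentiable:
  fixes \<theta> x :: "real ^ 'n"
  shows "quad_op \<theta> differentiable (at x)"
proof -
  have c: "((\<lambda>x :: real ^ 'n. x $ i) has_derivative (\<lambda>h. h $ i)) (at x)" for i
    by (rule bounded_linear_imp_has_derivative) (rule bounded_linear_vec_nth)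
  have d: "(\<lambda>x :: real ^ 'n. x $ i) differentiable (at x)" for i
    using c by (auto simp: differentiable_def)
  have "(\<lambda>x. quad_op \<theta> x \<bullet> b) differentiable (at x)" if b: "b \<in> Basis" for b
  proof -
    obtain k where k: "b = axis k 1"
      using b by (auto simp: Basis_vec_def)
    have "(\<lambda>x. \<theta> $ k * (1/2) * x $ k * (x $ k + 2 * (\<Sum>i\<in>UNIV - {k}. x $ i)))
            differentiable (at x)"
      by (intro differentiable_mult differentiable_add differentiable_sum
          differentiable_const d ballI finite)
    then show ?thesis
      unfolding k by (simp add: quad_op_def inner_axis)
  qed
  then show ?thesis
    by (subst differentiable_componentwise_within) auto
qed

end

theory Submission
  imports Defs
begin

text \<open>The operator is homogeneous of degree 2, so by Euler's identity its Jacobian at a fixed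
  point \<open>p\<close> satisfies \<open>J p = 2 H(p) = 2 p\<close>: every nonzero fixed point has the eigenvalue 2.\<close>

text \<open>Along the ray through \<open>x\<close>, the map \<open>t\<close> to
  \<open>F (t x)\<close> is differentiated at \<open>t = 1\<close> in two ways, by the chain rule
  and from the explicit power \<open>t ^ n\<close>; uniqueness of the derivative equates the
  results.\<close>

lemma frechet_derivative_homogeneous:
  fixes F :: "'a::real_normed_vector \<Rightarrow> 'b::real_normed_vector"
  assumes "F differentiable (at x)"
    and hom: "\<And>t::real. F (t *\<^sub>R x) = t ^ n *\<^sub>R F x"
  shows "frechet_derivative F (at x) x = real n *\<^sub>R F x"
proof -
  let ?D = "frechet_derivative F (at x)"
  have "((\<lambda>t::real. t *\<^sub>R x) has_derivative (\<lambda>h. h *\<^sub>R x)) (at 1)"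
    by (auto intro!: derivative_eq_intros)
  \<comment> \<open>The base point is written as the value of the inner map at \<open>1\<close>, the
    form that the chain rule expects.\<close>
  moreover have "(F has_derivative ?D) (at (1 *\<^sub>R x))"
    using assms(1) by (simp add: frechet_derivative_works)
  ultimately have "((\<lambda>t. F (t *\<^sub>R x)) has_derivative (\<lambda>h. ?D (h *\<^sub>R x))) (at 1)"
    by (rule has_derivative_compose)
  moreover have "((\<lambda>t. F (t *\<^sub>R x)) has_derivative (\<lambda>h. (real n * h) *\<^sub>R F x)) (at 1)"
    unfolding hom by (auto intro!: derivative_eq_intros simp: mult.commute)
  ultimately have "(\<lambda>h. ?D (h *\<^sub>R x)) = (\<lambda>h. (real n * h) *\<^sub>R F x)"
    by (rule has_derivative_unique)
  from fun_cong[OF this, of 1] show ?thesis by simp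
qed

lemma quad_op_scaleR: "quad_op \<theta> (t *\<^sub>R x) = t\<^sup>2 *\<^sub>R quad_op \<theta> x"
  by (simp add: quad_op_def vec_eq_iff power2_eq_square algebra_simps flip: sum_distrib_left)

text \<open>Eigenvalues are taken over the complex numbers, so the real eigenvector is embedded
  entrywise; the embedding commutes with the sums and products in \<open>A *v v\<close>.\<close>

lemma complex_eigenvalue_of_real:
  fixes A :: "real ^ 'n ^ 'n"
  assumes "A *v v = c *\<^sub>R v" and "v \<noteq> 0"
  shows "complex_eigenvalue A (complex_of_real c)"
  unfolding complex_eigenvalue_def
proof (intro exI conjI)
  let ?w = "(\<chi> i. complex_of_real (v $ i)) :: complex ^ 'n"
  show "?w \<noteq> 0"
    using assms(2) by (simp add: vec_eq_iff)
  have "(\<Sum>j\<in>UNIV. A $ i $ j * v $ j) = c * v $ i" for i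
    using arg_cong[OF assms(1), of "\<lambda>u. u $ i"] by (simp add: matrix_vector_mult_def)
  then show "map_matrix complex_of_real A *v ?w = complex_of_real c *s ?w"
    by (simp add: vec_eq_iff matrix_vector_mult_def map_matrix_def flip: of_real_mult of_real_sum)
qed

theorem corollary2:
  fixes \<theta> :: "real ^ 'n"
  assumes "CARD('n) \<ge> 2"
    and "\<And>k. 0 < \<theta> $ k"
  shows "\<not> (\<exists>p \<in> nonneg_orthant. attracting_fixed_point (quad_op \<theta>) p \<and> p \<noteq> 0)"
proof clarify
  fix p :: "real ^ 'n"
  assume att: "attracting_fixed_point (quad_op \<theta>) p" and "p \<noteq> 0"
  \<comment> \<open>Differentiability makes the derivative linear, so its matrix acts on
    \<open>p\<close> as the derivative itself.\<close>
  have "jacobian (quad_op \<theta>) (at p) *v p = frechet_derivative (quad_op \<theta>) (at p) p"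
    by (simp add: jacobian_def matrix_works linear_matrix_vector_mul_eq
        linear_frechet_derivative[OF quad_op_differentiable])
  also have "\<dots> = 2 *\<^sub>R quad_op \<theta> p"
    using frechet_derivative_homogeneous[OF quad_op_differentiable quad_op_scaleR] by simp
  also have "quad_op \<theta> p = p"
    using att by (simp add: attracting_fixed_point_def)
  finally have "complex_eigenvalue (jacobian (quad_op \<theta>) (at p)) (complex_of_real 2)"
    using \<open>p \<noteq> 0\<close> by (rule complex_eigenvalue_of_real)
  \<comment> \<open>Attraction bounds every eigenvalue, in particular the eigenvalue 2 with
    eigenvector \<open>p\<close>.\<close>
  then have "cmod (complex_of_real 2) < 1"
    using att unfolding attracting_fixed_point_def by blast
  then show False by simp
qed

end
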